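(* Let $R$ be a unital commutative ring, $\mathcal A$ a commutative unital $R$-algebra, $D_1,\dots,D_n$ $R$-derivations of $\mathcal A$ (not assumed to commute), and $D=(D_1,\dots,D_n)$. Let $0\neq P(\xi)\in\mathcal A\langle\xi\rangle$ be a polynomial in $n$ noncommutative free variables $\xi=(\xi_1,\dots,\xi_n)$, written as $P(\xi)=a_0+\sum_{k=1}^d P_k(\xi)$ with $a_0\in\mathcal A$, $d\ge 1$ and $P_k(\xi)$ homogeneous of degree $k$ in $\xi$ $(1\le k\le d)$. Let $u\in\mathcal A$ be such that $u^m\in\operatorname{Ker}P(D)$ for all $1\le m\le d$. Then $$a_0u^d=(-1)^d\,d!\,P_d(\nabla u).$$ Furthermore, if $u^{d+1}$ also lies in $\operatorname{Ker}P(D)$, then $$a_0u^{d+1}=0.$$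
   Context: An $R$-derivation of $\mathcal A$ is an $R$-linear map $\delta:\mathcal A\to\mathcal A$ with $\delta(ab)=\delta(a)b+a\delta(b)$. $\mathcal A\langle\xi\rangle$ is the polynomial algebra over $\mathcal A$ in the noncommutative free variables $\xi_1,\dots,\xi_n$ (coefficients commute with the variables). For $u\in\mathcal A$, $\nabla u:=(D_1u,\dots,D_nu)$. The operator $P(D):\mathcal A\to\mathcal A$ and the element $P_d(\nabla u)\in\mathcal A$ are obtained by first writing all coefficients of the polynomial on the left of the monomials in $\xi$, and then replacing each $\xi_i$ by $D_i$ (products being compositions, coefficients acting by multiplication), respectively by $D_iu$. $\operatorname{Ker}P(D)=\{a\in\mathcal A: P(D)(a)=0\}$. *)

theory Defs
  imports Complex_Main "HOL-Library.Poly_Mapping"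
begin

locale comm_algebra = module scale
  for scale :: "'r::comm_ring_1 \<Rightarrow> 'a::comm_ring_1 \<Rightarrow> 'a" (infixr \<open>*s\<close> 75) +
  assumes scale_mult_left: "(r *s a) * b = r *s (a * b)"

locale algebra_derivation = comm_algebra scale + module_hom scale scale \<delta>
  for scale :: "'r::comm_ring_1 \<Rightarrow> 'a::comm_ring_1 \<Rightarrow> 'a" (infixr \<open>*s\<close> 75)
    and \<delta> :: "'a \<Rightarrow> 'a" +
  assumes Leibniz: "\<delta> (a * b) = \<delta> a * b + a * \<delta> b"


text \<open>
  The free (noncommutative) polynomial algebra is the monoid algebra of the free monoid.
  Poly_Mapping equips finitely supported functions with the convolution product whenever the
  index type is an additively written, not necessarily commutative, monoid. So words are wrapped
  in a type of their own, on which addition is concatenation.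
\<close>

datatype 'n monomial = Monomial (letters: "'n list")

instantiation monomial :: (type) monoid_add
begin

definition zero_monomial :: "'a monomial" where
  "0 = Monomial []"

definition plus_monomial :: "'a monomial \<Rightarrow> 'a monomial \<Rightarrow> 'a monomial" where
  "v + w = Monomial (letters v @ letters w)"

instance
  by standard (simp_all add: zero_monomial_def plus_monomial_def)

end

type_synonym ('n, 'a) ncpoly = "'n monomial \<Rightarrow>\<^sub>0 'a"

definition ncconst :: "'a::comm_ring_1 \<Rightarrow> ('n, 'a) ncpoly" where
  "ncconst a = Poly_Mapping.single 0 a"

definition ncvar :: "'n \<Rightarrow> ('n, 'a::comm_ring_1) ncpoly" where
  "ncvar i = Poly_Mapping.single (Monomial [i]) 1"

text \<open>The zero polynomial is homogeneous of every degree.\<close>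

definition nchomogeneous :: "nat \<Rightarrow> ('n, 'a::comm_ring_1) ncpoly \<Rightarrow> bool" where
  "nchomogeneous k p \<longleftrightarrow> (\<forall>w\<in>Poly_Mapping.keys p. length (letters w) = k)"

text \<open>\<open>P(D)\<close>: the word \<open>i\<^sub>1 \<dots> i\<^sub>k\<close> becomes the composition \<open>D i\<^sub>1 \<circ> \<dots> \<circ> D i\<^sub>k\<close>.\<close>

definition diff_op :: "('n, 'a::comm_ring_1) ncpoly \<Rightarrow> ('n \<Rightarrow> 'a \<Rightarrow> 'a) \<Rightarrow> 'a \<Rightarrow> 'a" where
  "diff_op p D a = (\<Sum>w\<in>Poly_Mapping.keys p.
     Poly_Mapping.lookup p w * foldr (\<circ>) (map D (letters w)) id a)"

definition diff_ker :: "('n, 'a::comm_ring_1) ncpoly \<Rightarrow> ('n \<Rightarrow> 'a \<Rightarrow> 'a) \<Rightarrow> 'a set" where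
  "diff_ker p D = {a. diff_op p D a = 0}"

definition nceval :: "('n, 'a::comm_ring_1) ncpoly \<Rightarrow> ('n \<Rightarrow> 'a) \<Rightarrow> 'a" where
  "nceval p x = (\<Sum>w\<in>Poly_Mapping.keys p.
     Poly_Mapping.lookup p w * prod_list (map x (letters w)))"

definition grad :: "('n \<Rightarrow> 'a \<Rightarrow> 'a) \<Rightarrow> 'a \<Rightarrow> 'n \<Rightarrow> 'a" where
  "grad D u = (\<lambda>i. D i u)"


text \<open>
  Coefficients commute with the variables, and every polynomial is the sum of its monomials with
  the coefficients written on the left, which is the form used for substitution above.
\<close>

lemma ncconst_ncvar_commute: "ncconst a * ncvar i = ncvar i * ncconst a"
  by (simp add: ncconst_def ncvar_def mult_single)

lemma prod_list_ncvar:
  "prod_list (map ncvar xs) = Poly_Mapping.single (Monomial xs) (1::'a::comm_ring_1)"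
  by (induction xs)
     (simp_all add: ncvar_def mult_single plus_monomial_def flip: zero_monomial_def)

lemma ncpoly_left_normal_form:
  "p = (\<Sum>w\<in>Poly_Mapping.keys p.
     ncconst (Poly_Mapping.lookup p w) * prod_list (map ncvar (letters w)))"
proof (rule poly_mapping_eqI)
  fix v
  have "Poly_Mapping.lookup (\<Sum>w\<in>Poly_Mapping.keys p.
      ncconst (Poly_Mapping.lookup p w) * prod_list (map ncvar (letters w))) v
    = (\<Sum>w\<in>Poly_Mapping.keys p. if w = v then Poly_Mapping.lookup p w else 0)"
    by (simp add: lookup_sum ncconst_def prod_list_ncvar mult_single lookup_single when_def)
  also have "\<dots> = Poly_Mapping.lookup p v"
    by (simp add: in_keys_iff)
  finally show "Poly_Mapping.lookup p v = Poly_Mapping.lookup (\<Sum>w\<in>Poly_Mapping.keys p.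
      ncconst (Poly_Mapping.lookup p w) * prod_list (map ncvar (letters w))) v" ..
qed

end

theory Submission
  imports Defs
begin

text \<open>
  Let \<open>L = P(D)\<close>, an operator of order at most \<open>d\<close>. The \<open>N\<close>-fold commutator of \<open>L\<close> with
  multiplication by \<open>u\<close>, applied to \<open>1\<close>, is \<open>\<Sum>m\<le>N. (N choose m) (-u)\<^sup>N\<^sup>-\<^sup>m L(u\<^sup>m)\<close>. Each commutator
  lowers the order by one, so this sum vanishes for \<open>N > d\<close> and equals \<open>d! P\<^sub>d(\<nabla>u)\<close> for \<open>N = d\<close>.
  On the other hand, if \<open>L\<close> kills \<open>u, \<dots>, u\<^sup>N\<close>, only the term \<open>(-u)\<^sup>N L(1) = (-u)\<^sup>N a\<^sub>0\<close> remains.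
\<close>

definition comm_sum :: "'a::comm_ring_1 \<Rightarrow> nat \<Rightarrow> ('a \<Rightarrow> 'a) \<Rightarrow> 'a" where
  "comm_sum u N g = (\<Sum>m\<le>N. of_nat (N choose m) * (- u) ^ (N - m) * g (u ^ m))"

context algebra_derivation
begin

lemma deriv_one: "\<delta> 1 = 0"
  using Leibniz[of 1 1] by simp

lemma deriv_of_nat: "\<delta> (of_nat n) = 0"
  by (induction n) (simp_all add: zero add deriv_one)

lemma deriv_power: "\<delta> (a ^ n) = of_nat n * a ^ (n - 1) * \<delta> a"
proof (induction n)
  case 0
  then show ?case by (simp add: deriv_one)
next
  case (Suc n)
  then show ?case by (cases n) (simp_all add: Leibniz algebra_simps)
qed

text \<open>Commutation with \<open>u\<close> obeys a Leibniz rule over compositions. The first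
  commutator of \<open>\<delta>\<close> is multiplication by \<open>\<delta> u\<close> and the later
  ones vanish, so only two terms of the expansion survive.\<close>

lemma comm_sum_deriv_comp:
  "comm_sum u (Suc N) (\<delta> \<circ> g) = \<delta> (comm_sum u (Suc N) g) + of_nat (Suc N) * \<delta> u * comm_sum u N g"
proof -
  let ?s = "\<lambda>m. of_nat (Suc N choose m) * (- u) ^ (Suc N - m) * \<delta> (g (u ^ m))"
  let ?t = "\<lambda>m. of_nat (Suc N choose m) * (of_nat (Suc N - m) * (- u) ^ (N - m)) * \<delta> u * g (u ^ m)"
  \<comment> \<open>The binomial coefficient is killed by \<open>\<delta>\<close>; the minus sign
    before \<open>?t m\<close> comes from \<open>\<delta> (- u)\<close>.\<close>
  have "\<delta> (of_nat (Suc N choose m) * (- u) ^ (Suc N - m) * g (u ^ m)) = ?s m - ?t m" for m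
    by (simp add: Leibniz deriv_power deriv_of_nat neg mult.assoc algebra_simps)
  then have "\<delta> (comm_sum u (Suc N) g) = (\<Sum>m\<le>Suc N. ?s m) - (\<Sum>m\<le>Suc N. ?t m)"
    unfolding comm_sum_def by (simp only: sum sum_subtractf)
  \<comment> \<open>The term \<open>m = Suc N\<close> drops out through its factor
    \<open>of_nat (Suc N - m)\<close>.\<close>
  also have "(\<Sum>m\<le>Suc N. ?t m) = (\<Sum>m\<le>N. ?t m)"
    by simp
  also have "\<dots> = of_nat (Suc N) * \<delta> u * comm_sum u N g"
    unfolding comm_sum_def sum_distrib_left
  proof (rule sum.cong)
    fix m assume "m \<in> {..N}"
    then have "(Suc N choose m) * (Suc N - m) = Suc N * (N choose m)"
      using binomial_absorb_comp[of "Suc N" m] by (simp add: mult.commute)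
    then have absorb: "of_nat (Suc N choose m) * of_nat (Suc N - m) = (of_nat (Suc N) * of_nat (N choose m) :: 'a)"
      by (simp only: flip: of_nat_mult)
    have "?t m = (of_nat (Suc N choose m) * of_nat (Suc N - m)) * ((- u) ^ (N - m) * \<delta> u * g (u ^ m))"
      by (simp only: mult.assoc)
    then show "?t m = of_nat (Suc N) * \<delta> u * (of_nat (N choose m) * (- u) ^ (N - m) * g (u ^ m))"
      unfolding absorb by (simp only: mult_ac)
  qed simp
  finally show ?thesis
    by (simp add: comm_sum_def)
qed

end

text \<open>The identity commutes with multiplication by \<open>u\<close>; in formulas, this is the
  binomial theorem for \<open>u + - u\<close>, with \<open>0 ^ 0 = 1\<close>.\<close>

lemma comm_sum_id: "comm_sum u N id = (if N = 0 then 1 else 0)"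
proof -
  have "comm_sum u N id = (u + - u) ^ N"
    unfolding comm_sum_def binomial_ring by (simp add: mult_ac)
  also have "\<dots> = (if N = 0 then 1 else 0)"
    by (simp add: power_0_left)
  finally show ?thesis .
qed

text \<open>Peeling off the outermost letter \<open>i\<close> trades one commutator for the factor
  \<open>N * D i u\<close>; these factors build up the factorial and the product. The induction
  keeps \<open>N\<close> arbitrary because the shorter word is met at both \<open>N\<close> and
  \<open>N - 1\<close>.\<close>

lemma comm_sum_word:
  assumes D: "\<And>i. algebra_derivation scale (D i)" and "length xs \<le> N"
  shows "comm_sum u N (foldr (\<circ>) (map D xs) id) =
    (if length xs = N then of_nat (fact N) * prod_list (map (grad D u) xs) else 0)"
  using \<open>length xs \<le> N\<close>
proof (induction xs arbitrary: N)
  case Nil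
  then show ?case by (simp add: comm_sum_id[unfolded id_def])
next
  case (Cons i xs)
  interpret algebra_derivation scale "D i" by (rule D)
  obtain M where "N = Suc M" "length xs \<le> M"
    using Cons.prems by (cases N) auto
  have "comm_sum u N (foldr (\<circ>) (map D (i # xs)) id) =
      D i (comm_sum u N (foldr (\<circ>) (map D xs) id)) +
      of_nat N * D i u * comm_sum u M (foldr (\<circ>) (map D xs) id)"
    unfolding \<open>N = Suc M\<close> list.map foldr.simps comp_apply[of "(\<circ>) (D i)"]
    by (rule comm_sum_deriv_comp)
  \<comment> \<open>Here \<open>xs\<close> is strictly shorter than \<open>N\<close>, which is the
    vanishing case of the induction hypothesis.\<close>
  also have "comm_sum u N (foldr (\<circ>) (map D xs) id) = 0"
    using \<open>N = Suc M\<close> \<open>length xs \<le> M\<close> by (subst Cons.IH) simp_all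
  also note Cons.IH[OF \<open>length xs \<le> M\<close>]
  also have "D i 0 + of_nat N * D i u *
        (if length xs = M then of_nat (fact M) * prod_list (map (grad D u) xs) else 0) =
      (if length (i # xs) = N then of_nat (fact N) * prod_list (map (grad D u) (i # xs)) else 0)"
    using \<open>N = Suc M\<close> by (simp add: zero grad_def algebra_simps)
  finally show ?case .
qed

lemma word_op_one:
  assumes "\<And>i. algebra_derivation scale (D i)"
  shows "foldr (\<circ>) (map D xs) id 1 = (if xs = [] then 1 else 0)"
proof -
  have "D i 0 = 0" "D i 1 = 0" for i
    using assms[of i] algebra_derivation.deriv_one
    by (auto simp: algebra_derivation_def intro: module_hom.zero)
  then show ?thesis by (induction xs) auto
qed

lemma comm_sum_diff_op:
  "comm_sum u N (diff_op p D) = (\<Sum>w\<in>Poly_Mapping.keys p.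
    Poly_Mapping.lookup p w * comm_sum u N (foldr (\<circ>) (map D (letters w)) id))"
  unfolding comm_sum_def diff_op_def sum_distrib_left
  by (subst sum.swap) (simp add: mult_ac)

lemma comm_sum_of_kernel:
  assumes "\<And>m. 1 \<le> m \<Longrightarrow> m \<le> N \<Longrightarrow> g (u ^ m) = 0"
  shows "comm_sum u N g = (- u) ^ N * g 1"
proof -
  have "comm_sum u N g = (\<Sum>m\<in>{0}. of_nat (N choose m) * (- u) ^ (N - m) * g (u ^ m))"
    unfolding comm_sum_def using assms
    by (intro sum.mono_neutral_right) auto
  then show ?thesis by simp
qed

text \<open>Components of different degrees share no word, so the length of a word tells which
  summand supplies its coefficient.\<close>

lemma lookup_homogeneous_decomposition:
  fixes Pk :: "nat \<Rightarrow> ('n, 'a::comm_ring_1) ncpoly"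
  assumes "\<And>k. 1 \<le> k \<Longrightarrow> k \<le> d \<Longrightarrow> nchomogeneous k (Pk k)"
  shows "Poly_Mapping.lookup (ncconst a0 + (\<Sum>k=1..d. Pk k)) w =
    (if letters w = [] then a0
     else if length (letters w) \<le> d then Poly_Mapping.lookup (Pk (length (letters w))) w else 0)"
proof -
  have "(\<Sum>k=1..d. Poly_Mapping.lookup (Pk k) w) =
      (\<Sum>k=1..d. if k = length (letters w) then Poly_Mapping.lookup (Pk k) w else 0)"
  proof (intro sum.cong refl)
    fix k assume "k \<in> {1..d}"
    then have "nchomogeneous k (Pk k)" using assms by simp
    then show "Poly_Mapping.lookup (Pk k) w =
        (if k = length (letters w) then Poly_Mapping.lookup (Pk k) w else 0)"
      by (auto simp: nchomogeneous_def in_keys_iff)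
  qed
  moreover have "0 = w \<longleftrightarrow> letters w = []"
    by (cases w) (auto simp: zero_monomial_def)
  ultimately show ?thesis
    by (simp add: lookup_add lookup_sum ncconst_def lookup_single when_def Suc_le_eq)
qed

theorem theorem2p1:
  fixes scale :: "'r::comm_ring_1 \<Rightarrow> 'a::comm_ring_1 \<Rightarrow> 'a"
    and D :: "'n::finite \<Rightarrow> 'a \<Rightarrow> 'a"
    and P :: "('n, 'a) ncpoly"
    and Pk :: "nat \<Rightarrow> ('n, 'a) ncpoly"
    and a0 u :: 'a
    and d :: nat
  assumes "comm_algebra scale"
    and "\<And>i. algebra_derivation scale (D i)"
    and "P \<noteq> 0"
    and "d \<ge> 1"
    and "\<And>k. 1 \<le> k \<Longrightarrow> k \<le> d \<Longrightarrow> nchomogeneous k (Pk k)"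
    and "P = ncconst a0 + (\<Sum>k=1..d. Pk k)"
    and "\<And>m. 1 \<le> m \<Longrightarrow> m \<le> d \<Longrightarrow> u ^ m \<in> diff_ker P D"
  shows "a0 * u ^ d = (-1) ^ d * of_nat (fact d) * nceval (Pk d) (grad D u)
    \<and> (u ^ (d + 1) \<in> diff_ker P D \<longrightarrow> a0 * u ^ (d + 1) = 0)"
proof -
  note lookup_P = lookup_homogeneous_decomposition[of d Pk a0, OF assms(5), folded assms(6)]
  have len: "length (letters w) \<le> d" if "w \<in> Poly_Mapping.keys P" for w
    using that lookup_P[of w] by (auto simp: in_keys_iff split: if_splits)
  \<comment> \<open>By \<open>d \<ge> 1\<close> a word of length \<open>d\<close> is nonempty, so
    \<open>a0\<close> does not enter its coefficient.\<close>
  have keys_Pd: "Poly_Mapping.keys (Pk d) = {w \<in> Poly_Mapping.keys P. length (letters w) = d}"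
  proof -
    have "w \<in> Poly_Mapping.keys (Pk d) \<longleftrightarrow> w \<in> Poly_Mapping.keys P" if "length (letters w) = d" for w
      using that assms(4) lookup_P[of w] by (auto simp: in_keys_iff)
    then show ?thesis
      using assms(4) assms(5)[of d] by (auto simp: nchomogeneous_def)
  qed

  have "diff_op P D 1 = (\<Sum>w\<in>Poly_Mapping.keys P. if w = 0 then a0 else 0)"
    unfolding diff_op_def word_op_one[OF assms(2)]
    by (intro sum.cong) (auto simp: lookup_P zero_monomial_def monomial.expand)
  \<comment> \<open>If the empty word is not a key, then its coefficient \<open>a0\<close> is zero
    and the empty sum is still right.\<close>
  also have "\<dots> = a0"
    using lookup_P[of 0] by (auto simp: in_keys_iff zero_monomial_def)
  finally have one: "diff_op P D 1 = a0" .

  have sign: "(- 1) ^ n * ((- u) ^ n * a0) = a0 * u ^ n" for n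
  proof -
    have "(- 1) ^ n * (- u) ^ n = u ^ n"
      by (simp flip: power_mult_distrib)
    then show ?thesis
      by (metis mult.assoc mult.commute)
  qed

  have "(- u) ^ d * a0 = comm_sum u d (diff_op P D)"
    using assms(7) by (subst comm_sum_of_kernel) (auto simp: diff_ker_def one)
  \<comment> \<open>Words shorter than \<open>d\<close> are annihilated by \<open>d\<close>
    commutators; only the top degree remains.\<close>
  also have "\<dots> = (\<Sum>w\<in>Poly_Mapping.keys P. if length (letters w) = d then
      of_nat (fact d) * (Poly_Mapping.lookup P w * prod_list (map (grad D u) (letters w))) else 0)"
    unfolding comm_sum_diff_op
    by (intro sum.cong) (auto simp: comm_sum_word[OF assms(2) len] mult_ac)
  also have "\<dots> = (\<Sum>w\<in>Poly_Mapping.keys (Pk d).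
      of_nat (fact d) * (Poly_Mapping.lookup P w * prod_list (map (grad D u) (letters w))))"
    unfolding keys_Pd by (simp add: sum.inter_filter)
  also have "\<dots> = of_nat (fact d) * nceval (Pk d) (grad D u)"
    unfolding nceval_def sum_distrib_left
    using assms(4) by (intro sum.cong) (auto simp: lookup_P keys_Pd)
  finally have "(- 1) ^ d * ((- u) ^ d * a0) = (- 1) ^ d * of_nat (fact d) * nceval (Pk d) (grad D u)"
    by (simp add: mult.assoc)
  then have "a0 * u ^ d = (- 1) ^ d * of_nat (fact d) * nceval (Pk d) (grad D u)"
    unfolding sign .
  moreover have "a0 * u ^ (d + 1) = 0" if "u ^ (d + 1) \<in> diff_ker P D"
  proof -
    have "diff_op P D (u ^ m) = 0" if "1 \<le> m" "m \<le> d + 1" for m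
      using that assms(7)[of m] \<open>u ^ (d + 1) \<in> diff_ker P D\<close>
      by (cases "m = d + 1") (auto simp: diff_ker_def)
    then have "(- u) ^ (d + 1) * a0 = comm_sum u (d + 1) (diff_op P D)"
      by (subst comm_sum_of_kernel) (auto simp: one)
    \<comment> \<open>There is now one commutator more than any word of \<open>P\<close> has
      letters, so every summand vanishes.\<close>
    also have "\<dots> = 0"
      unfolding comm_sum_diff_op
    proof (intro sum.neutral ballI)
      fix w assume "w \<in> Poly_Mapping.keys P"
      then show "Poly_Mapping.lookup P w * comm_sum u (d + 1) (foldr (\<circ>) (map D (letters w)) id) = 0"
        using len[of w] comm_sum_word[OF assms(2), of "letters w" "d + 1" u] by simp
    qed
    finally have "(- 1) ^ (d + 1) * ((- u) ^ (d + 1) * a0) = 0"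
      by (simp only: mult_zero_right)
    then show ?thesis
      unfolding sign .
  qed
  ultimately show ?thesis by blast
qed

end
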